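(* Let $B$ and $R$ be two finite $C_4$-free graphs on the same vertex set $V$. Then $$\omega(G(B,R))\leq \omega(B)+\omega(R)+\omega(H(B,R)).$$
   Context: All graphs are simple (no loops or multiple edges). For two graphs $B,R$ on the same vertex set $V$, $G(B,R)$ is the graph with vertex set $V$ in which two vertices are adjacent if they are adjacent in at least one of $B$ and $R$, and $H(B,R)$ is the graph with vertex set $V$ in which two vertices are adjacent if they are adjacent in both $B$ and $R$. A clique is a set of pairwise adjacent vertices, and $\omega(G)$ is the maximal size of a clique in $G$. A graph is $C_4$-free if none of its induced subgraphs is isomorphic to the cycle $C_4$ on four vertices. *)

theory Defs
  imports "Graph_Theory.Graph_Theory"
begin

text \<open>
  A finite simple graph is a \<^locale>\<open>pair_graph\<close>: a finite, loop-free, symmetric arc relation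
  on a finite vertex set, so that an edge between \<open>u\<close> and \<open>v\<close> is the pair of arcs
  \<open>(u, v)\<close> and \<open>(v, u)\<close>. The null graph is allowed.
\<close>

definition clique :: "('a, 'b) pre_digraph \<Rightarrow> 'a set \<Rightarrow> bool" where
  "clique G K \<longleftrightarrow> K \<subseteq> verts G \<and> (\<forall>u\<in>K. \<forall>v\<in>K. u \<noteq> v \<longrightarrow> u \<rightarrow>\<^bsub>G\<^esub> v)"

text \<open>
  For a finite graph the maximum below is over a finite nonempty set, since the empty set is
  a clique; the null graph has clique number 0.
\<close>

definition clique_number :: "('a, 'b) pre_digraph \<Rightarrow> nat" where
  "clique_number G = Max {card K | K. clique G K}"

definition cycle4 :: "nat pair_pre_digraph" where
  "cycle4 = \<lparr> pverts = {..<4},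
              parcs = {(i, j). i < 4 \<and> j < 4 \<and> (j = (i + 1) mod 4 \<or> i = (j + 1) mod 4)} \<rparr>"

definition C4_free :: "('a, 'b) pre_digraph \<Rightarrow> bool" where
  "C4_free G \<longleftrightarrow> \<not> (\<exists>H. induced_subgraph H G \<and> digraph_iso H cycle4)"

text \<open>
  The next two are used only for graphs on the same vertex set, where the union and the
  intersection of the vertex sets are that set.
\<close>

definition either_graph ::
    "'a pair_pre_digraph \<Rightarrow> 'a pair_pre_digraph \<Rightarrow> 'a pair_pre_digraph" where
  "either_graph B R = \<lparr> pverts = pverts B \<union> pverts R, parcs = {(u, v). u \<rightarrow>\<^bsub>B\<^esub> v \<or> u \<rightarrow>\<^bsub>R\<^esub> v} \<rparr>"

definition both_graph ::
    "'a pair_pre_digraph \<Rightarrow> 'a pair_pre_digraph \<Rightarrow> 'a pair_pre_digraph" where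
  "both_graph B R = \<lparr> pverts = pverts B \<inter> pverts R, parcs = {(u, v). u \<rightarrow>\<^bsub>B\<^esub> v \<and> u \<rightarrow>\<^bsub>R\<^esub> v} \<rparr>"

end

theory Submission
  imports Defs
begin

text \<open>
  Fix a clique \<open>K\<close> of the union and colour its pairs: a pair missing from \<open>B\<close> is red (it lies
  in \<open>R\<close> only), a pair missing from \<open>R\<close> is blue. No pair is both red and blue, and
  \<open>C\<^sub>4\<close>-freeness of \<open>B\<close> and \<open>R\<close> says that no two disjoint red edges induce a \<open>2K\<^sub>2\<close> in the red
  graph, and likewise for blue. A clique of \<open>B\<close> is a set without red edges, a clique of \<open>R\<close> is one
  without blue edges, so the theorem follows once \<open>K\<close> is covered by three sets: one without red
  edges, one without blue edges, and one without either.

  The only obstacle to covering \<open>K\<close> by the first two kinds alone is a pentagon, that is, five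
  vertices on which red and blue form two complementary five-cycles.

  \<^item> If there is a pentagon, every vertex sends no blue edge to it, or no red edge to it, or is a
    twin of one of its corners, and the cover can be read off from these classes:
    the twins of a single corner supply the third set
    (lemma \<open>cover_if_pentagon\<close>).

  \<^item> If there is none, then covering \<open>K\<close> by two sets is a 2-satisfiability problem: each vertex is
    put into \<open>X\<close> or \<open>Y\<close>, no red edge may lie in \<open>X\<close> and no blue edge in \<open>Y\<close>. At each vertex \<open>v\<close>,
    either the red neighbours span no blue edge or the blue neighbours span no red edge
    (lemma \<open>pentagon_if_two_triangles\<close>). In the first case, putting \<open>v\<close> into \<open>X\<close> and propagating
    along alternating paths never leads to a contradiction (lemma \<open>layer_edgeless\<close>); the second
    case is the same with the colours exchanged. All vertices reached are thereby decided without
    constraining the others, and induction finishes the cover.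
\<close>

section \<open>Pairs of graphs without an induced pair of disjoint edges\<close>

definition edgeless :: "('a \<Rightarrow> 'a \<Rightarrow> bool) \<Rightarrow> 'a set \<Rightarrow> bool" where
  "edgeless E S \<longleftrightarrow> (\<forall>u\<in>S. \<forall>v\<in>S. \<not> E u v)"

lemma edgelessI: "(\<And>u v. u \<in> S \<Longrightarrow> v \<in> S \<Longrightarrow> E u v \<Longrightarrow> False) \<Longrightarrow> edgeless E S"
  unfolding edgeless_def by blast

lemma edgelessD: "edgeless E S \<Longrightarrow> u \<in> S \<Longrightarrow> v \<in> S \<Longrightarrow> \<not> E u v"
  unfolding edgeless_def by blast

locale two_K2_free =
  fixes E :: "'a \<Rightarrow> 'a \<Rightarrow> bool"
  assumes sym: "E u v \<Longrightarrow> E v u"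
    and irrefl: "\<not> E u u"
    and linked: "E u v \<Longrightarrow> E x y \<Longrightarrow> u \<noteq> x \<Longrightarrow> u \<noteq> y \<Longrightarrow> v \<noteq> x \<Longrightarrow> v \<noteq> y \<Longrightarrow>
      E u x \<or> E u y \<or> E v x \<or> E v y"

locale red_blue = r: two_K2_free r + b: two_K2_free b
  for r b :: "'a \<Rightarrow> 'a \<Rightarrow> bool" +
  assumes disjoint: "r u v \<Longrightarrow> \<not> b u v"
begin

lemma swap: "red_blue b r"
  using disjoint by unfold_locales blast

end

section \<open>A pentagon gives the cover with three sets\<close>

definition pentagon :: "('a \<Rightarrow> 'a \<Rightarrow> bool) \<Rightarrow> ('a \<Rightarrow> 'a \<Rightarrow> bool) \<Rightarrow> 'a \<Rightarrow> 'a \<Rightarrow> 'a \<Rightarrow> 'a \<Rightarrow> 'a \<Rightarrow> bool"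
  where
  "pentagon r b c0 c1 c2 c3 c4 \<longleftrightarrow>
     r c0 c1 \<and> r c1 c2 \<and> r c2 c3 \<and> r c3 c4 \<and> r c4 c0 \<and>
     b c0 c2 \<and> b c2 c4 \<and> b c4 c1 \<and> b c1 c3 \<and> b c3 c0"

definition twins :: "('a \<Rightarrow> 'a \<Rightarrow> bool) \<Rightarrow> ('a \<Rightarrow> 'a \<Rightarrow> bool) \<Rightarrow> 'a \<Rightarrow> 'a \<Rightarrow> 'a \<Rightarrow> 'a \<Rightarrow> 'a \<Rightarrow> 'a set"
  where
  "twins r b c0 c1 c2 c3 c4 = {v. r v c1 \<and> r v c4 \<and> b v c2 \<and> b v c3}"

definition unseen :: "('a \<Rightarrow> 'a \<Rightarrow> bool) \<Rightarrow> 'a set \<Rightarrow> 'a set" where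
  "unseen E C = {v. \<forall>c\<in>C. \<not> E v c}"

lemma pentagon_rotate: "pentagon r b c0 c1 c2 c3 c4 \<Longrightarrow> pentagon r b c1 c2 c3 c4 c0"
  unfolding pentagon_def by blast

text \<open>The blue edges of a pentagon form a five-cycle too, along which one walks in steps of two.\<close>

lemma (in red_blue) pentagon_swap: "pentagon r b c0 c1 c2 c3 c4 \<Longrightarrow> pentagon b r c0 c2 c4 c1 c3"
  unfolding pentagon_def using r.sym b.sym by blast

lemma twins_swap: "twins b r c0 c2 c4 c1 c3 = twins r b c0 c1 c2 c3 c4"
  unfolding twins_def by blast

context red_blue
begin

text \<open>
  The blue edge \<open>c1 c4\<close> receives no blue edge from a twin of \<open>c0\<close>, nor from a vertex that sends
  no blue edge to the pentagon. A blue edge between such vertices would form a \<open>2K\<^sub>2\<close> with it.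
\<close>

lemma unseen_twins_edgeless:
  assumes "pentagon r b c0 c1 c2 c3 c4"
  shows "edgeless b (unseen b {c0, c1, c2, c3, c4} \<union> twins r b c0 c1 c2 c3 c4)"
proof (rule edgelessI)
  fix u v
  assume u: "u \<in> unseen b {c0, c1, c2, c3, c4} \<union> twins r b c0 c1 c2 c3 c4"
    and v: "v \<in> unseen b {c0, c1, c2, c3, c4} \<union> twins r b c0 c1 c2 c3 c4"
    and uv: "b u v"
  have c: "b c4 c1" "b c1 c4" "b c1 c3" "b c2 c4"
    using assms b.sym unfolding pentagon_def by auto
  have off: "\<not> b w c1 \<and> \<not> b w c4 \<and> w \<noteq> c1 \<and> w \<noteq> c4"
    if "w \<in> unseen b {c0, c1, c2, c3, c4} \<union> twins r b c0 c1 c2 c3 c4" for w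
    using that c disjoint r.irrefl unfolding unseen_def twins_def by blast
  from b.linked[OF uv c(1)] off[OF u] off[OF v] show False by blast
qed

text \<open>
  For twins \<open>u\<close> and \<open>v\<close> of consecutive corners \<open>c0\<close> and \<open>c1\<close>, a blue edge \<open>uv\<close> would make
  the red edges \<open>u c4\<close> and \<open>v c2\<close> induce a \<open>2K\<^sub>2\<close>: the other three pairs between them are blue.
\<close>

lemma consecutive_twins:
  assumes pent: "pentagon r b c0 c1 c2 c3 c4"
    and u: "u \<in> twins r b c0 c1 c2 c3 c4" and v: "v \<in> twins r b c1 c2 c3 c4 c0"
  shows "\<not> b u v"
proof
  assume uv: "b u v"
  have edges: "r u c4" "r v c2" "b u c2" "b v c4" "b c2 c4"
    using pent u v unfolding pentagon_def twins_def by auto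
  have "\<not> r u v" "\<not> r u c2" "\<not> r c4 v" "\<not> r c4 c2"
    using uv edges disjoint b.sym by blast+
  moreover have "u \<noteq> v" "u \<noteq> c2" "c4 \<noteq> v" "c4 \<noteq> c2"
    using uv edges b.irrefl by blast+
  ultimately show False
    using r.linked[OF edges(1,2)] by blast
qed

lemma blue_edgeless_class:
  assumes pent: "pentagon r b c0 c1 c2 c3 c4"
  shows "edgeless b (unseen b {c0, c1, c2, c3, c4}
           \<union> twins r b c0 c1 c2 c3 c4 \<union> twins r b c1 c2 c3 c4 c0)"
proof -
  have "{c1, c2, c3, c4, c0} = {c0, c1, c2, c3, c4}" by auto
  with unseen_twins_edgeless[OF pent] unseen_twins_edgeless[OF pentagon_rotate[OF pent]]
    consecutive_twins[OF pent] b.sym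
  show ?thesis unfolding edgeless_def by (metis UnE UnI1 UnI2)
qed

text \<open>The corner \<open>c0\<close> has no red edge to the opposite red edge \<open>c2 c3\<close>, so \<open>v\<close> must have one.\<close>

lemma red_edge_to_corner:
  assumes pent: "pentagon r b c0 c1 c2 c3 c4" and v: "r v c0"
  shows "r v c2 \<or> r v c3"
proof -
  have edges: "r c2 c3" "b c0 c2" "b c3 c0" using pent unfolding pentagon_def by auto
  have "\<not> r c0 c2" "\<not> r c0 c3" using edges disjoint b.sym by blast+
  moreover have "v \<noteq> c2" "v \<noteq> c3" "c0 \<noteq> c2" "c0 \<noteq> c3"
    using edges v disjoint b.sym r.sym b.irrefl by blast+
  ultimately show ?thesis using r.linked[OF v edges(1)] by blast
qed

lemma blue_edge_to_corner:
  assumes "pentagon r b c0 c1 c2 c3 c4" and "b v c0"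
  shows "b v c4 \<or> b v c1"
  using red_blue.red_edge_to_corner[OF swap pentagon_swap] assms by blast

text \<open>
  By the previous lemma, a blue edge from \<open>v\<close> to a corner comes with another one to a neighbour of
  that corner on the red five-cycle. The neighbours \<open>c1\<close> and \<open>c4\<close> of \<open>c0\<close> are excluded, being red
  to \<open>v\<close>, which excludes \<open>c0\<close> as well and leaves \<open>c2\<close> and \<open>c3\<close> only each other.
\<close>

lemma twin_if_two_red:
  assumes pent: "pentagon r b c0 c1 c2 c3 c4" and red: "r v c4" "r v c1"
    and seen: "v \<notin> unseen b {c0, c1, c2, c3, c4}"
  shows "v \<in> twins r b c0 c1 c2 c3 c4"
proof -
  note p1 = pentagon_rotate[OF pent]
  note p2 = pentagon_rotate[OF p1]
  note p3 = pentagon_rotate[OF p2]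
  have no: "\<not> b v c1" "\<not> b v c4" using red disjoint by blast+
  then have "\<not> b v c0" using blue_edge_to_corner[OF pent] by blast
  then have "b v c2 \<or> b v c3" using seen no unfolding unseen_def by blast
  then have "b v c2 \<and> b v c3"
    using blue_edge_to_corner[OF p2] blue_edge_to_corner[OF p3] no by blast
  then show ?thesis using red unfolding twins_def by blast
qed

lemma pentagon_classes:
  assumes pent: "pentagon r b c0 c1 c2 c3 c4"
  shows "v \<in> unseen b {c0, c1, c2, c3, c4} \<union> unseen r {c0, c1, c2, c3, c4}
    \<union> twins r b c0 c1 c2 c3 c4 \<union> twins r b c1 c2 c3 c4 c0 \<union> twins r b c2 c3 c4 c0 c1
    \<union> twins r b c3 c4 c0 c1 c2 \<union> twins r b c4 c0 c1 c2 c3"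
proof (cases "v \<in> unseen b {c0, c1, c2, c3, c4} \<or> v \<in> unseen r {c0, c1, c2, c3, c4}")
  case False
  note p0 = pent note p1 = pentagon_rotate[OF p0] note p2 = pentagon_rotate[OF p1]
  note p3 = pentagon_rotate[OF p2] note p4 = pentagon_rotate[OF p3]
  have seen: "v \<notin> unseen b {c0, c1, c2, c3, c4}" "v \<notin> unseen b {c1, c2, c3, c4, c0}"
    "v \<notin> unseen b {c2, c3, c4, c0, c1}" "v \<notin> unseen b {c3, c4, c0, c1, c2}"
    "v \<notin> unseen b {c4, c0, c1, c2, c3}"
    using False by (simp_all add: insert_commute)
  have "r v c0 \<or> r v c1 \<or> r v c2 \<or> r v c3 \<or> r v c4"
    using False unfolding unseen_def by blast
  then have "r v c4 \<and> r v c1 \<or> r v c0 \<and> r v c2 \<or> r v c1 \<and> r v c3 \<or> r v c2 \<and> r v c4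
      \<or> r v c3 \<and> r v c0"
    using red_edge_to_corner[OF p0] red_edge_to_corner[OF p1] red_edge_to_corner[OF p2]
      red_edge_to_corner[OF p3] red_edge_to_corner[OF p4] by metis
  then show ?thesis
    using twin_if_two_red[OF p0 _ _ seen(1)] twin_if_two_red[OF p1 _ _ seen(2)]
      twin_if_two_red[OF p2 _ _ seen(3)] twin_if_two_red[OF p3 _ _ seen(4)]
      twin_if_two_red[OF p4 _ _ seen(5)]
    by (elim disjE) simp_all
qed blast

lemma cover_if_pentagon:
  assumes pent: "pentagon r b c0 c1 c2 c3 c4"
  shows "\<exists>X Y Z. V \<subseteq> X \<union> Y \<union> Z \<and>
           edgeless r X \<and> edgeless b Y \<and> edgeless r Z \<and> edgeless b Z"
proof -
  interpret sw: red_blue b r by (rule swap)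
  \<comment> \<open>The corners \<open>c2\<close> and \<open>c4\<close> are consecutive on the blue five-cycle, as \<open>c0\<close> and \<open>c1\<close> are on
    the red one; the remaining corner is \<open>c3\<close>.\<close>
  define Y where "Y = unseen b {c0, c1, c2, c3, c4} \<union> twins r b c0 c1 c2 c3 c4
    \<union> twins r b c1 c2 c3 c4 c0"
  define X where "X = unseen r {c0, c1, c2, c3, c4} \<union> twins r b c2 c3 c4 c0 c1
    \<union> twins r b c4 c0 c1 c2 c3"
  define Z where "Z = twins r b c3 c4 c0 c1 c2"
  note p2 = pentagon_rotate[OF pentagon_rotate[OF pent]]
  note p3 = pentagon_rotate[OF p2]
  have set: "{c2, c4, c1, c3, c0} = {c0, c1, c2, c3, c4}" by auto
  have "edgeless b Y"
    unfolding Y_def by (rule blue_edgeless_class[OF pent])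
  moreover have "edgeless r X"
    using sw.blue_edgeless_class[OF pentagon_swap[OF p2]]
    unfolding X_def set twins_swap[of b r] .
  moreover have "edgeless b Z"
    using unseen_twins_edgeless[OF p3] unfolding Z_def edgeless_def by blast
  moreover have "edgeless r Z"
    using sw.unseen_twins_edgeless[OF pentagon_swap[OF p3]]
    unfolding Z_def twins_swap[of b r] edgeless_def by blast
  moreover have "V \<subseteq> X \<union> Y \<union> Z"
  proof
    fix v
    show "v \<in> X \<union> Y \<union> Z"
      using pentagon_classes[OF pent, of v] unfolding X_def Y_def Z_def Un_iff by argo
  qed
  ultimately show ?thesis by (intro exI[of _ X] exI[of _ Y] exI[of _ Z] conjI)
qed

text \<open>
  Let \<open>v a c\<close> be a triangle with blue edge \<open>ac\<close> opposite \<open>v\<close> and \<open>v d e\<close> one with red edge \<open>de\<close>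
  opposite \<open>v\<close>, the other edges at \<open>v\<close> being red and blue, respectively. One red edge between
  \<open>{a, c}\<close> and \<open>{d, e}\<close>, say \<open>ad\<close>, determines the rest: \<open>v d\<close> and \<open>ac\<close> can only be
  linked in blue by \<open>dc\<close>, then \<open>v c\<close> and \<open>de\<close> in red by \<open>ce\<close>, then \<open>v e\<close> and \<open>ac\<close> in blue by \<open>ea\<close>.
\<close>

lemma pentagon_if_two_triangles:
  assumes va: "r v a" and vc: "r v c" and ac: "b a c" and vd: "b v d" and ve: "b v e" and de: "r d e"
  shows "\<exists>c0 c1 c2 c3 c4. pentagon r b c0 c1 c2 c3 c4"
proof -
  have ne: "v \<noteq> a" "v \<noteq> c" "v \<noteq> d" "v \<noteq> e" "a \<noteq> d" "a \<noteq> e" "c \<noteq> d" "c \<noteq> e"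
    using assms r.irrefl b.irrefl disjoint by blast+
  have no: "\<not> r v d" "\<not> r v e" "\<not> b v a" "\<not> b v c"
    using assms disjoint by blast+
  have la: "r a d \<or> r a e" using r.linked[OF va de] ne no by blast
  have lc: "r c d \<or> r c e" using r.linked[OF vc de] ne no by blast
  have ld: "b d a \<or> b d c" using b.linked[OF vd ac] ne no by blast
  have le: "b e a \<or> b e c" using b.linked[OF ve ac] ne no by blast
  have s: "r x y \<longleftrightarrow> r y x" "b x y \<longleftrightarrow> b y x" for x y using r.sym b.sym by blast+
  from la show ?thesis
  proof
    assume ad: "r a d"
    then have "b d c" using ld disjoint s by blast
    moreover from this have "r c e" using lc disjoint s by blast
    moreover from this have "b e a" using le disjoint s by blast
    ultimately have "pentagon r b v a d e c"
      using assms ad s unfolding pentagon_def by blast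
    then show ?thesis by blast
  next
    assume ae: "r a e"
    then have "b e c" using le disjoint s by blast
    moreover from this have "r c d" using lc disjoint s by blast
    moreover from this have "b d a" using ld disjoint s by blast
    ultimately have "pentagon r b v a e d c"
      using assms ae s unfolding pentagon_def by blast
    then show ?thesis by blast
  qed
qed

end

section \<open>Propagation along alternating paths\<close>

definition colour :: "('a \<Rightarrow> 'a \<Rightarrow> bool) \<Rightarrow> ('a \<Rightarrow> 'a \<Rightarrow> bool) \<Rightarrow> nat \<Rightarrow> 'a \<Rightarrow> 'a \<Rightarrow> bool" where
  "colour r b n = (if even n then r else b)"

text \<open>
  If \<open>v\<close> is put into \<open>X\<close>, the vertices in even layers are forced into \<open>X\<close> and those in odd layers
  into \<open>Y\<close>. Layers need not be disjoint: a vertex belongs to layer \<open>n\<close> for each alternating walk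
  of length \<open>n\<close> that leads to it.
\<close>

primrec layer :: "('a \<Rightarrow> 'a \<Rightarrow> bool) \<Rightarrow> ('a \<Rightarrow> 'a \<Rightarrow> bool) \<Rightarrow> 'a \<Rightarrow> nat \<Rightarrow> 'a set" where
  "layer r b v 0 = {v}"
| "layer r b v (Suc n) = {w. \<exists>u\<in>layer r b v n. colour r b n u w}"

text \<open>
  A partial solution of the 2-satisfiability problem that imposes nothing on the other vertices:
  every neighbour in the critical colour has been assigned too.
\<close>

definition decided :: "('a \<Rightarrow> 'a \<Rightarrow> bool) \<Rightarrow> ('a \<Rightarrow> 'a \<Rightarrow> bool) \<Rightarrow> 'a set \<Rightarrow> 'a set \<Rightarrow> bool" where
  "decided r b X Y \<longleftrightarrow> edgeless r X \<and> edgeless b Y \<and>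
     (\<forall>u\<in>X. \<forall>w. r u w \<longrightarrow> w \<in> Y) \<and> (\<forall>u\<in>Y. \<forall>w. b u w \<longrightarrow> w \<in> X)"

lemma decided_swap: "decided b r Y X \<longleftrightarrow> decided r b X Y"
  unfolding decided_def by blast

context red_blue
begin

lemma colour_two_K2_free: "two_K2_free (colour r b n)"
  unfolding colour_def using r.two_K2_free_axioms b.two_K2_free_axioms by auto

lemma colour_disjoint: "colour r b n u w \<Longrightarrow> \<not> colour r b (Suc n) u w"
  unfolding colour_def using disjoint by (auto split: if_splits)

lemma colour_add_even: "colour r b (n + 2 * d) = colour r b n"
  unfolding colour_def by simp

text \<open>
  Vertices in layers of equal parity are forced to the same side; an edge between them of the
  colour forbidden on that side is a conflict. A conflict between two layers closes an alternating walk of odd length through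
  \<open>v\<close>. Its middle edge is a conflict inside a single layer.
\<close>

lemma conflict_in_middle_layer:
  assumes "u \<in> layer r b v i" "w \<in> layer r b v (i + 2 * d)" "colour r b i u w"
  shows "\<not> edgeless (colour r b (i + d)) (layer r b v (i + d))"
  using assms
proof (induction d arbitrary: i u w)
  case 0
  then show ?case unfolding edgeless_def by auto
next
  case (Suc d)
  from Suc.prems(2) obtain w' where
    w': "w' \<in> layer r b v (Suc i + 2 * d)" "colour r b (Suc i + 2 * d) w' w"
    by auto
  have "w \<in> layer r b v (Suc i)" using Suc.prems(1,3) by auto
  moreover have "colour r b (Suc i) w w'"
    using w'(2) two_K2_free.sym[OF colour_two_K2_free] unfolding colour_add_even by blast
  ultimately show ?case using Suc.IH[of w "Suc i" w'] w'(1) by simp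
qed

text \<open>
  Suppose an edge \<open>x2 y2\<close> is a conflict in layer \<open>k + 2\<close>, and follow both ends back by alternating
  walks \<open>x0 x1 x2\<close> and \<open>y0 y1 y2\<close>. As there is no conflict between layers \<open>k\<close> and \<open>k + 2\<close>, the edges
  \<open>x0 x1\<close> and \<open>x2 y2\<close> can be linked only by \<open>x1 y2\<close>, and symmetrically \<open>y1 x2\<close> is an edge of the same
  colour. Then nothing links the edges \<open>x1 x2\<close> and \<open>y1 y2\<close> of the other colour. This needs two
  earlier layers; a conflict in layer 1 is excluded by the hypothesis.
\<close>

lemma layer_edgeless:
  assumes start: "edgeless b {x. r v x}"
  shows "edgeless (colour r b n) (layer r b v n)"
proof (induction n)
  case 0
  then show ?case using r.irrefl by (simp add: edgeless_def colour_def)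
next
  case (Suc m)
  show ?case
  proof (cases m)
    case 0
    then show ?thesis using start by (simp add: edgeless_def colour_def)
  next
    case (Suc k)
    let ?A = "colour r b k" and ?B = "colour r b (Suc k)"
    interpret A: two_K2_free ?A by (rule colour_two_K2_free)
    interpret B: two_K2_free ?B by (rule colour_two_K2_free)
    have clean: "edgeless ?B (layer r b v (Suc k))"
      using Suc.IH Suc by simp
    have far: "\<not> ?A u w" if "u \<in> layer r b v k" "w \<in> layer r b v (Suc (Suc k))" for u w
      using conflict_in_middle_layer[of u v k w 1] that clean by auto
    have AA: "colour r b (Suc (Suc k)) = ?A" using colour_add_even[of k 1] by simp
    have "edgeless ?A (layer r b v (Suc (Suc k)))"
    proof (rule edgelessI)
      fix x2 y2
      assume x2: "x2 \<in> layer r b v (Suc (Suc k))" and y2: "y2 \<in> layer r b v (Suc (Suc k))"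
        and conflict: "?A x2 y2"
      have cross: "?A p1 q2"
        if p2: "p2 \<in> layer r b v (Suc (Suc k))" and q2: "q2 \<in> layer r b v (Suc (Suc k))"
          and p1: "p1 \<in> layer r b v (Suc k)" "?B p1 p2"
          and q1: "q1 \<in> layer r b v (Suc k)" "?B q1 q2" and pq: "?A p2 q2"
        for p1 p2 q1 q2
      proof -
        from p1(1) obtain p0 where p0: "p0 \<in> layer r b v k" "?A p0 p1" by auto
        have "\<not> ?A p1 p2" using p1(2) colour_disjoint by blast
        moreover have "\<not> ?A p0 p2" "\<not> ?A p0 q2" using far p0(1) p2 q2 by blast+
        moreover have "p0 \<noteq> p2" "p0 \<noteq> q2" using far p0(1) p2 q2 pq A.sym by blast+
        moreover have "p1 \<noteq> p2" using p1(2) B.irrefl by blast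
        moreover have "p1 \<noteq> q2" using q1 p1(1) clean unfolding edgeless_def by blast
        ultimately show ?thesis using A.linked[OF p0(2) pq] by blast
      qed
      from x2 obtain x1 where x1: "x1 \<in> layer r b v (Suc k)" "?B x1 x2" by auto
      from y2 obtain y1 where y1: "y1 \<in> layer r b v (Suc k)" "?B y1 y2" by auto
      have "?A x1 y2" using cross[OF x2 y2 x1 y1 conflict] .
      moreover have "?A x2 y1" using A.sym[OF cross[OF y2 x2 y1 x1 A.sym[OF conflict]]] .
      ultimately have "\<not> ?B x1 y2" "\<not> ?B x2 y1" "\<not> ?B x2 y2" "x1 \<noteq> y1" "x1 \<noteq> y2" "x2 \<noteq> y1" "x2 \<noteq> y2"
        using conflict colour_disjoint y1(2) A.irrefl by blast+
      moreover have "\<not> ?B x1 y1" using clean x1(1) y1(1) unfolding edgeless_def by blast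
      ultimately show False using B.linked[OF x1(2) y1(2)] by blast
    qed
    then show ?thesis using Suc AA by simp
  qed
qed

lemma same_parity_layers:
  assumes start: "edgeless b {x. r v x}"
    and "u \<in> layer r b v i" "w \<in> layer r b v j" "even i \<longleftrightarrow> even j"
  shows "\<not> colour r b i u w"
proof -
  have le: "\<not> colour r b i u w"
    if "i \<le> j" "even i \<longleftrightarrow> even j" "u \<in> layer r b v i" "w \<in> layer r b v j" for i j u w
  proof -
    have "even (j - i)" using that(1,2) by simp
    then obtain d where "j - i = 2 * d" by (rule evenE)
    then have "j = i + 2 * d" using that(1) by simp
    then show ?thesis
      using conflict_in_middle_layer layer_edgeless[OF start] that(3,4) by blast
  qed
  have "colour r b i = colour r b j" using assms(4) unfolding colour_def by simp
  then show ?thesis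
    using le[of i j u w] le[of j i w u] assms(2-4) two_K2_free.sym[OF colour_two_K2_free]
    by (metis nat_le_linear)
qed

lemma decided_by_layers:
  assumes start: "edgeless b {x. r v x}"
  shows "\<exists>X Y. v \<in> X \<and> decided r b X Y"
proof (intro exI conjI)
  let ?X = "{u. \<exists>i. even i \<and> u \<in> layer r b v i}" and ?Y = "{u. \<exists>i. odd i \<and> u \<in> layer r b v i}"
  show "v \<in> ?X" by (auto intro!: exI[of _ 0])
  show "decided r b ?X ?Y"
    unfolding decided_def
  proof (intro conjI ballI allI impI)
    show "edgeless r ?X"
    proof (rule edgelessI, clarify)
      fix u w i j
      assume "even i" "u \<in> layer r b v i" "even j" "w \<in> layer r b v j" "r u w"
      then show False using same_parity_layers[OF start, of u i w j] by (simp add: colour_def)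
    qed
    show "edgeless b ?Y"
    proof (rule edgelessI, clarify)
      fix u w i j
      assume "odd i" "u \<in> layer r b v i" "odd j" "w \<in> layer r b v j" "b u w"
      then show False using same_parity_layers[OF start, of u i w j] by (simp add: colour_def)
    qed
  next
    fix u w
    assume "u \<in> ?X" and uw: "r u w"
    then obtain i where "even i" "u \<in> layer r b v i" by blast
    then have "odd (Suc i)" "w \<in> layer r b v (Suc i)" using uw by (auto simp: colour_def)
    then show "w \<in> ?Y" by blast
  next
    fix u w
    assume "u \<in> ?Y" and uw: "b u w"
    then obtain i where "odd i" "u \<in> layer r b v i" by blast
    then have "even (Suc i)" "w \<in> layer r b v (Suc i)" using uw by (auto simp: colour_def)
    then show "w \<in> ?X" by blast
  qed
qed

lemma decided_if_no_pentagon: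
  assumes "\<nexists>c0 c1 c2 c3 c4. pentagon r b c0 c1 c2 c3 c4"
  shows "\<exists>X Y. v \<in> X \<union> Y \<and> decided r b X Y"
proof (cases "edgeless b {x. r v x}")
  case True
  then show ?thesis using decided_by_layers by blast
next
  case False
  then have "edgeless r {x. b v x}"
    using pentagon_if_two_triangles assms unfolding edgeless_def by blast
  from red_blue.decided_by_layers[OF swap this] show ?thesis
    using decided_swap[of b r] by blast
qed

lemma cover_if_no_pentagon:
  assumes no_pentagon: "\<nexists>c0 c1 c2 c3 c4. pentagon r b c0 c1 c2 c3 c4" and "finite V"
  shows "\<exists>X Y. V \<subseteq> X \<union> Y \<and> edgeless r X \<and> edgeless b Y"
  using \<open>finite V\<close>
proof (induction V rule: finite_psubset_induct)
  case (psubset V)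
  show ?case
  proof (cases "V = {}")
    case True
    then show ?thesis unfolding edgeless_def by blast
  next
    case False
    then obtain v where "v \<in> V" by blast
    from decided_if_no_pentagon[OF no_pentagon, of v]
    obtain X0 Y0 where v: "v \<in> X0 \<union> Y0" and dec: "decided r b X0 Y0" by blast
    have "V - (X0 \<union> Y0) \<subset> V" using v \<open>v \<in> V\<close> by blast
    from psubset.IH[OF this] obtain X1 Y1 where
      cover: "V - (X0 \<union> Y0) \<subseteq> X1 \<union> Y1" and e: "edgeless r X1" "edgeless b Y1" by blast
    \<comment> \<open>\<open>X1\<close> and \<open>Y1\<close> may reach into the decided part, so the two solutions have to be made
      compatible before they are combined.\<close>
    have "edgeless r (X0 \<union> (X1 - Y0))"
      using dec e(1) r.sym unfolding decided_def edgeless_def by blast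
    moreover have "edgeless b (Y0 \<union> (Y1 - X0))"
      using dec e(2) b.sym unfolding decided_def edgeless_def by blast
    moreover have "V \<subseteq> (X0 \<union> (X1 - Y0)) \<union> (Y0 \<union> (Y1 - X0))" using cover by blast
    ultimately show ?thesis by blast
  qed
qed

theorem three_set_cover:
  assumes "finite V"
  shows "\<exists>X Y Z. V \<subseteq> X \<union> Y \<union> Z \<and>
           edgeless r X \<and> edgeless b Y \<and> edgeless r Z \<and> edgeless b Z"
proof (cases "\<exists>c0 c1 c2 c3 c4. pentagon r b c0 c1 c2 c3 c4")
  case True
  then show ?thesis by (elim exE) (rule cover_if_pentagon)
next
  case False
  from cover_if_no_pentagon[OF this assms] obtain X Y where
    "V \<subseteq> X \<union> Y" "edgeless r X" "edgeless b Y" by blast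
  moreover have "edgeless r {}" "edgeless b {}" unfolding edgeless_def by auto
  ultimately show ?thesis by (intro exI[of _ X] exI[of _ Y] exI[of _ "{}"]) simp
qed

end

section \<open>Cliques in the union of two graphs\<close>

lemma pair_graph_dominates_sym:
  assumes "pair_graph G" "u \<rightarrow>\<^bsub>with_proj G\<^esub> v"
  shows "v \<rightarrow>\<^bsub>with_proj G\<^esub> u"
proof -
  interpret pair_graph G by fact
  show ?thesis using arcs_ends_symmetric[OF pair_sym_arcs] assms(2) by blast
qed

text \<open>
  The complement of \<open>C\<^sub>4\<close> is \<open>2K\<^sub>2\<close>: four vertices whose only non-adjacent pairs are \<open>a c\<close>
  and \<open>b d\<close> induce the cycle \<open>a b c d\<close>.
\<close>

lemma C4_free_missing_pairs:
  assumes G: "pair_graph G" and free: "C4_free (with_proj G)"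
    and verts: "a \<in> pverts G" "b \<in> pverts G" "c \<in> pverts G" "d \<in> pverts G"
    and distinct: "distinct [a, b, c, d]"
    and missing: "(a, c) \<notin> parcs G" "(b, d) \<notin> parcs G"
  shows "\<not> ((a, b) \<in> parcs G \<and> (b, c) \<in> parcs G \<and> (c, d) \<in> parcs G \<and> (d, a) \<in> parcs G)"
proof
  assume cyc: "(a, b) \<in> parcs G \<and> (b, c) \<in> parcs G \<and> (c, d) \<in> parcs G \<and> (d, a) \<in> parcs G"
  interpret pair_graph G by fact
  have arcs: "(b, a) \<in> parcs G" "(c, b) \<in> parcs G" "(d, c) \<in> parcs G" "(a, d) \<in> parcs G"
    "(c, a) \<notin> parcs G" "(d, b) \<notin> parcs G"
    using cyc missing pair_graph_dominates_sym[OF G] by auto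
  have loops: "(u, u) \<notin> parcs G" for u using pair_no_loops by fastforce
  define Q where "Q = {a, b, c, d}"
  define A where "A = {(a, b), (b, a), (b, c), (c, b), (c, d), (d, c), (d, a), (a, d)}"
  define H where "H = \<lparr> pverts = Q, parcs = A \<rparr>"
  define h where "h x = (if x = a then 0 else if x = b then 1 else if x = c then 2 else 3 :: nat)" for x
  define f where "f = \<lparr> iso_verts = h, iso_arcs = map_prod h h, iso_head = snd, iso_tail = fst \<rparr>"
  have "(x, y) \<in> A" if "(x, y) \<in> parcs G" "x \<in> Q" "y \<in> Q" for x y
    using that(2,3,1) missing arcs(5,6) loops unfolding A_def Q_def
    by (elim insertE emptyE) simp_all
  moreover have "A \<subseteq> parcs G" using cyc arcs unfolding A_def by simp
  moreover have A_verts: "A \<subseteq> Q \<times> Q" unfolding A_def Q_def by simp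
  ultimately have A: "A = {e \<in> parcs G. fst e \<in> Q \<and> snd e \<in> Q}"
    by fastforce
  have wf: "wf_digraph (with_proj H)"
    by unfold_locales (use A_verts in \<open>auto simp: H_def\<close>)
  have "Q \<subseteq> pverts G" using verts unfolding Q_def by simp
  then have "subgraph (with_proj H) (with_proj G)"
    using wf wf_digraph A
    by (intro subgraphI) (auto simp: H_def compatible_def)
  then have "induced_subgraph (with_proj H) (with_proj G)"
    using A by (intro induced_subgraphI) (auto simp: H_def)
  moreover have "digraph_iso (with_proj H) (with_proj cycle4)"
    unfolding digraph_iso_def
  proof (intro exI conjI)
    have inj: "inj_on h Q" using distinct by (auto simp: inj_on_def h_def Q_def)
    have "inj_on (map_prod h h) A"
      using inj_on_subset[OF map_prod_inj_on[OF inj inj] A_verts] .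
    then show "pre_digraph.digraph_isomorphism (with_proj H) f"
      using wf inj unfolding pre_digraph.digraph_isomorphism_def by (auto simp: H_def f_def)
    have h: "h a = 0" "h b = 1" "h c = 2" "h d = 3" using distinct by (auto simp: h_def)
    have less4: "i < 4 \<longleftrightarrow> i = 0 \<or> i = 1 \<or> i = 2 \<or> i = 3" for i :: nat by auto
    have "parcs cycle4 = {(0, 1), (1, 0), (1, 2), (2, 1), (2, 3), (3, 2), (3, 0), (0, 3)}"
      by (auto simp: cycle4_def less4)
    then have "parcs cycle4 = map_prod h h ` A" unfolding A_def by (simp add: h)
    moreover have "pverts cycle4 = h ` Q"
      by (auto simp: cycle4_def less4 h Q_def)
    ultimately show "with_proj cycle4 = app_iso f (with_proj H)"
      by (simp add: with_proj_def app_iso_def f_def H_def)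
  qed
  ultimately show False using free unfolding C4_free_def by blast
qed

lemma C4_free_complement:
  assumes G: "pair_graph G" and free: "C4_free (with_proj G)" and K: "K \<subseteq> pverts G"
  shows "two_K2_free (\<lambda>u v. u \<in> K \<and> v \<in> K \<and> u \<noteq> v \<and> (u, v) \<notin> parcs G)"
proof
  fix u v x y
  have sym: "(u, v) \<in> parcs G \<longleftrightarrow> (v, u) \<in> parcs G" for u v
    using pair_graph_dominates_sym[OF G] by auto
  show "u \<in> K \<and> v \<in> K \<and> u \<noteq> v \<and> (u, v) \<notin> parcs G \<Longrightarrow>
        v \<in> K \<and> u \<in> K \<and> v \<noteq> u \<and> (v, u) \<notin> parcs G" using sym by blast
  show "\<not> (u \<in> K \<and> u \<in> K \<and> u \<noteq> u \<and> (u, u) \<notin> parcs G)" by blast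
  assume uv: "u \<in> K \<and> v \<in> K \<and> u \<noteq> v \<and> (u, v) \<notin> parcs G"
    and xy: "x \<in> K \<and> y \<in> K \<and> x \<noteq> y \<and> (x, y) \<notin> parcs G"
    and "u \<noteq> x" "u \<noteq> y" "v \<noteq> x" "v \<noteq> y"
  then show "u \<in> K \<and> x \<in> K \<and> u \<noteq> x \<and> (u, x) \<notin> parcs G \<or>
       u \<in> K \<and> y \<in> K \<and> u \<noteq> y \<and> (u, y) \<notin> parcs G \<or>
       v \<in> K \<and> x \<in> K \<and> v \<noteq> x \<and> (v, x) \<notin> parcs G \<or>
       v \<in> K \<and> y \<in> K \<and> v \<noteq> y \<and> (v, y) \<notin> parcs G"
    using C4_free_missing_pairs[OF G free, of u x v y] K sym by auto
qed

lemma finite_clique_sizes: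
  assumes "finite (verts G)"
  shows "finite {card K | K. clique G K}"
proof -
  have "{card K | K. clique G K} \<subseteq> card ` Pow (verts G)" unfolding clique_def by auto
  then show ?thesis using assms finite_subset by blast
qed

lemma card_le_clique_number:
  "finite (verts G) \<Longrightarrow> clique G K \<Longrightarrow> card K \<le> clique_number G"
  unfolding clique_number_def by (rule Max_ge[OF finite_clique_sizes]) auto

lemma clique_number_attained:
  assumes "finite (verts G)"
  obtains K where "clique G K" "card K = clique_number G"
proof -
  have "clique G {}" unfolding clique_def by simp
  then have "{card K | K. clique G K} \<noteq> {}" by blast
  then have "clique_number G \<in> {card K | K. clique G K}"
    unfolding clique_number_def by (rule Max_in[OF finite_clique_sizes[OF assms]])
  then show ?thesis using that by auto
qed

theorem theorem1p10:
  fixes B R :: "'a pair_pre_digraph" and V :: "'a set"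
  assumes "pair_graph B" and "pair_graph R"
    and "pverts B = V" and "pverts R = V"
    and "C4_free B" and "C4_free R"
  shows "clique_number (either_graph B R)
           \<le> clique_number B + clique_number R + clique_number (both_graph B R)"
proof -
  have finV: "finite V" using assms(1,3) pair_fin_digraph.pair_finite_verts
    unfolding pair_graph_def pair_pseudo_graph_def by blast
  have fin: "finite (verts (either_graph B R))" "finite (verts B)" "finite (verts R)"
    "finite (verts (both_graph B R))"
    using finV assms(3,4) by (auto simp: either_graph_def both_graph_def)
  obtain K where K: "clique (either_graph B R) K"
    and card_K: "card K = clique_number (either_graph B R)"
    using clique_number_attained[OF fin(1)] by blast
  have KV: "K \<subseteq> V" using K assms(3,4) unfolding clique_def either_graph_def by auto
  have finK: "finite K" using KV finV finite_subset by blast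
  let ?r = "\<lambda>u v. u \<in> K \<and> v \<in> K \<and> u \<noteq> v \<and> (u, v) \<notin> parcs B"
  let ?b = "\<lambda>u v. u \<in> K \<and> v \<in> K \<and> u \<noteq> v \<and> (u, v) \<notin> parcs R"
  interpret r: two_K2_free ?r using C4_free_complement assms(1,3,5) KV by blast
  interpret b: two_K2_free ?b using C4_free_complement assms(2,4,6) KV by blast
  interpret red_blue ?r ?b
    by unfold_locales (use K in \<open>auto simp: clique_def either_graph_def\<close>)
  obtain X Y Z where cover: "K \<subseteq> X \<union> Y \<union> Z"
    and X: "edgeless ?r X" and Y: "edgeless ?b Y" and Z: "edgeless ?r Z" "edgeless ?b Z"
    using three_set_cover[OF finK] by blast
  have "clique B (K \<inter> X)" "clique R (K \<inter> Y)" "clique (both_graph B R) (K \<inter> Z)"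
    using X Y Z KV assms(3,4) unfolding clique_def edgeless_def both_graph_def by auto
  then have le: "card (K \<inter> X) \<le> clique_number B" "card (K \<inter> Y) \<le> clique_number R"
    "card (K \<inter> Z) \<le> clique_number (both_graph B R)"
    using card_le_clique_number fin by blast+
  have "K = (K \<inter> X) \<union> (K \<inter> Y) \<union> (K \<inter> Z)" using cover by blast
  then have "card K \<le> card (K \<inter> X) + card (K \<inter> Y) + card (K \<inter> Z)"
    by (metis (no_types, lifting) card_Un_le add_le_mono1 le_trans)
  then show ?thesis using le card_K by linarith
qed

end
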